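(* Let $\mathbb{K}$ be a field of characteristic zero and let $p,q$ be positive integers. The Lie subalgebra $\operatorname{Lie}(x^p,y^q)$ has finite codimension in $\mathbb{K}[x,y]$ (as a $\mathbb{K}$-vector subspace) if and only if $(p,q)=(2,3)$ or $(p,q)=(3,2)$.
   Context: The polynomial algebra $\mathbb{K}[x,y]$ is regarded as a Lie algebra over $\mathbb{K}$ with the standard Poisson bracket $\{f,h\}=\frac{\partial f}{\partial x}\frac{\partial h}{\partial y}-\frac{\partial f}{\partial y}\frac{\partial h}{\partial x}$. For $f,g\in\mathbb{K}[x,y]$, $\operatorname{Lie}(f,g)$ denotes the Lie subalgebra of $(\mathbb{K}[x,y],\{\cdot,\cdot\})$ generated by $f$ and $g$. *)

theory Defs
  imports "HOL-Computational_Algebra.Polynomial"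
begin

text \<open>
  The algebra \<open>K[x,y]\<close> is represented as \<open>K[x][y]\<close>, i.e. by the type \<open>'a poly poly\<close>: the outer
  polynomial variable is \<open>y\<close>, the inner one is \<open>x\<close>.
\<close>

definition var_x :: "'a::comm_ring_1 poly poly"
  where "var_x = [:[:0, 1:]:]"

definition var_y :: "'a::comm_ring_1 poly poly"
  where "var_y = [:0, 1:]"

definition scale2 :: "'a::comm_ring_1 \<Rightarrow> 'a poly poly \<Rightarrow> 'a poly poly"
  where "scale2 c f = smult [:c:] f"

definition diff_x :: "'a::idom poly poly \<Rightarrow> 'a poly poly"
  where "diff_x f = map_poly pderiv f"

definition diff_y :: "'a::idom poly poly \<Rightarrow> 'a poly poly"
  where "diff_y f = pderiv f"

definition poisson :: "'a::idom poly poly \<Rightarrow> 'a poly poly \<Rightarrow> 'a poly poly"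
  where "poisson f h = diff_x f * diff_y h - diff_y f * diff_x h"

lemma scale2_var_power: "scale2 c (var_x ^ i * var_y ^ j) = monom (monom c i) j"
proof -
  have "var_x ^ i = [:monom (1::'a) i:]"
    by (induction i) (simp_all add: var_x_def one_pCons monom_Suc monom_0)
  moreover have "var_y ^ j = monom (1::'a poly) j"
    by (simp add: var_y_def monom_altdef)
  ultimately show ?thesis
    by (simp add: scale2_def smult_monom)
qed

lemma diff_x_monom: "diff_x (scale2 c (var_x ^ i * var_y ^ j)) =
    scale2 (of_nat i * c) (var_x ^ (i - 1) * var_y ^ j)"
  by (simp add: scale2_var_power diff_x_def map_poly_monom pderiv_monom)

lemma diff_y_monom: "diff_y (scale2 c (var_x ^ i * var_y ^ j)) =
    scale2 (of_nat j * c) (var_x ^ i * var_y ^ (j - 1))"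
  by (simp add: scale2_var_power diff_y_def pderiv_monom of_nat_poly smult_monom)

text \<open>
  A subspace \<open>W\<close> has finite codimension iff the quotient space by \<open>W\<close> is spanned by the classes of
  finitely many vectors; the classes of \<open>v\<close> and \<open>u\<close> agree iff \<open>v - u \<in> W\<close>.
\<close>

definition (in vector_space) finite_codim :: "'b set \<Rightarrow> bool"
  where "finite_codim W \<longleftrightarrow>
    subspace W \<and> (\<exists>B. finite B \<and> (\<forall>v. \<exists>u\<in>span B. v - u \<in> W))"

global_interpretation poly2: vector_space "scale2 :: 'a::field \<Rightarrow> 'a poly poly \<Rightarrow> 'a poly poly"
  by unfold_locales
    (simp_all add: scale2_def smult_add_right mult.commute flip: smult_add_left one_pCons)

definition lie_subalgebra :: "'a::field poly poly set \<Rightarrow> bool"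
  where "lie_subalgebra L \<longleftrightarrow> poly2.subspace L \<and> (\<forall>f\<in>L. \<forall>h\<in>L. poisson f h \<in> L)"

definition Lie :: "'a::field poly poly \<Rightarrow> 'a poly poly \<Rightarrow> 'a poly poly set"
  where "Lie f g = lie_subalgebra hull {f, g}"

lemma lie_subalgebra_Lie: "lie_subalgebra (Lie f g)"
  unfolding Lie_def
  by (rule hull_in) (auto simp: lie_subalgebra_def intro!: poly2.subspace_Inter)

lemma subspace_Lie: "poly2.subspace (Lie f g)"
  using lie_subalgebra_Lie by (auto simp: lie_subalgebra_def)

end

theory Submission
  imports Defs
begin

text \<open>
  A bracket of monomials is a multiple of a monomial:
  \<open>{x^a y^b, x^c y^d} = (a d - b c) x^(a+c-1) y^(b+d-1)\<close>. After shifting exponents by \<open>(1,1)\<close>, the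
  exponents occurring in \<open>Lie(x^p, y^q)\<close> are nonnegative combinations of \<open>(p-1,-1)\<close> and
  \<open>(-1,q-1)\<close>, whose determinant is \<open>D = (p-1)(q-1) - 1\<close>. If \<open>D \<noteq> \<plusminus>1\<close>, they miss infinitely many
  lattice points because of the congruence \<open>(q-1)(i-1) + (j-1) \<equiv> 0 (mod D)\<close>. If \<open>D = -1\<close>, then
  \<open>p = 1\<close> or \<open>q = 1\<close>, and one of the variables has degree at most \<open>1\<close>. If \<open>D = 1\<close>, then
  \<open>{p,q} = {2,3}\<close>, and \<open>Lie(x^2, y^3)\<close> contains all monomials except \<open>1, x, y, y^2, xy\<close>.
\<close>

section \<open>Monomials and their brackets\<close>

abbreviation mon :: "nat \<Rightarrow> nat \<Rightarrow> 'a::field_char_0 poly poly"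
  where "mon i j \<equiv> var_x ^ i * var_y ^ j"

lemma mon_eq_monom: "(mon i j :: 'a::field_char_0 poly poly) = monom (monom 1 i) j"
  using scale2_var_power[of "1::'a" i j] by (simp only: poly2.scale_one)

lemma coeff_mon:
  "coeff (coeff (mon i j :: 'a::field_char_0 poly poly) b) a = (if a = i \<and> b = j then 1 else 0)"
  by (auto simp: mon_eq_monom)

lemma coeff_scale2: "coeff (coeff (scale2 c f) b) a = c * coeff (coeff f b) a"
  by (simp add: scale2_def)

lemma coeff_diff_x: "coeff (coeff (diff_x f) b) a = of_nat (Suc a) * coeff (coeff f b) (Suc a)"
  by (simp add: diff_x_def coeff_map_poly coeff_pderiv)

lemma coeff_diff_y: "coeff (coeff (diff_y f) b) a = of_nat (Suc b) * coeff (coeff f (Suc b)) a"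
  by (simp add: diff_y_def coeff_pderiv of_nat_poly del: of_nat_Suc)

text \<open>Truncated subtraction is harmless: an exponent is truncated only if
  \<open>a = c = 0\<close> or \<open>b = d = 0\<close>, and then the scalar vanishes.\<close>

lemma poisson_mon:
  "poisson (mon a b) (mon c d :: 'a::field_char_0 poly poly) =
    scale2 (of_nat (a * d) - of_nat (b * c)) (mon (a + c - 1) (b + d - 1))"
proof -
  have dx: "diff_x (mon i j :: 'a poly poly) = monom (monom (of_nat i) (i - 1)) j" for i j
    by (simp add: mon_eq_monom diff_x_def map_poly_monom pderiv_monom)
  have dy: "diff_y (mon i j :: 'a poly poly) = monom (monom (of_nat j) i) (j - 1)" for i j
    by (simp add: mon_eq_monom diff_y_def pderiv_monom of_nat_poly smult_monom)
  have 1: "diff_x (mon a b) * diff_y (mon c d :: 'a poly poly) =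
      monom (monom (of_nat (a * d)) (a + c - 1)) (b + d - 1)"
    unfolding dx dy mult_monom by (cases "a = 0 \<or> d = 0") (auto simp: Suc_diff_le)
  have 2: "diff_y (mon a b) * diff_x (mon c d :: 'a poly poly) =
      monom (monom (of_nat (b * c)) (a + c - 1)) (b + d - 1)"
    unfolding dx dy mult_monom by (cases "b = 0 \<or> c = 0") (auto simp: Suc_diff_le)
  show ?thesis
    unfolding poisson_def 1 2 scale2_var_power by (simp add: diff_monom)
qed

text \<open>In characteristic zero the nonzero integer ad - bc is an invertible scalar, so the
  bracket can be divided by it.\<close>

lemma mon_mem_Lie:
  fixes f g :: "'a::field_char_0 poly poly"
  assumes "mon a b \<in> Lie f g" "mon c d \<in> Lie f g" "a * d \<noteq> b * c"
  shows "mon (a + c - 1) (b + d - 1) \<in> Lie f g"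
proof -
  let ?k = "of_nat (a * d) - of_nat (b * c) :: 'a"
  have "?k \<noteq> 0"
    using assms(3) by (metis eq_iff_diff_eq_0 of_nat_eq_iff)
  have "scale2 ?k (mon (a + c - 1) (b + d - 1)) \<in> Lie f g"
    using assms(1,2) lie_subalgebra_Lie[of f g] unfolding lie_subalgebra_def poisson_mon[symmetric]
    by blast
  from poly2.subspace_scale[OF subspace_Lie this, of "inverse ?k"] show ?thesis
    by (simp only: poly2.scale_scale left_inverse[OF \<open>?k \<noteq> 0\<close>] poly2.scale_one)
qed

lemma generators_mem_Lie: "f \<in> Lie f g" "g \<in> Lie f g"
  using hull_subset[of "{f, g}" lie_subalgebra] by (auto simp: Lie_def)

section \<open>Criterion for finite codimension\<close>

lemma subspace_UNIV_if_mon: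
  assumes "poly2.subspace V" "\<And>i j. (mon i j :: 'a::field_char_0 poly poly) \<in> V"
  shows "f \<in> V"
proof -
  have "(\<Sum>j\<le>degree f. \<Sum>i\<le>degree (coeff f j). scale2 (coeff (coeff f j) i) (mon i j)) \<in> V"
    by (intro poly2.subspace_sum poly2.subspace_scale assms)
  moreover have "(\<Sum>i\<le>degree c. scale2 (coeff c i) (mon i j)) = monom c j" for c :: "'a poly" and j
    by (subst poly_as_sum_of_monoms[of c, symmetric]) (simp add: scale2_var_power monom_sum)
  ultimately show ?thesis
    by (simp add: poly_as_sum_of_monoms)
qed

lemma finite_codim_if_mon:
  assumes W: "poly2.subspace W" and F: "finite F"
    and mem: "\<And>i j. (i, j) \<notin> F \<Longrightarrow> (mon i j :: 'a::field_char_0 poly poly) \<in> W"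
  shows "poly2.finite_codim W"
proof -
  let ?B = "(\<lambda>(i, j). mon i j :: 'a poly poly) ` F"
  let ?V = "{v. \<exists>u\<in>poly2.span ?B. v - u \<in> W}"
  have "?V = {u + w | u w. u \<in> poly2.span ?B \<and> w \<in> W}"
    by safe (metis add.commute diff_add_cancel, metis add_diff_cancel_left')
  then have V: "poly2.subspace ?V"
    using poly2.subspace_sums[OF poly2.subspace_span W] by simp
  have "mon i j \<in> ?V" for i j
  proof (cases "(i, j) \<in> F")
    case True
    then have "mon i j \<in> poly2.span ?B"
      by (auto intro!: poly2.span_base)
    then show ?thesis
      using poly2.subspace_0[OF W] by force
  next
    case False
    then show ?thesis
      using mem poly2.span_zero by force
  qed
  then have "v \<in> ?V" for v
    using subspace_UNIV_if_mon[OF V] by blast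
  then show ?thesis
    using W F unfolding poly2.finite_codim_def by blast
qed

section \<open>Subspaces given by exponent sets and infinite codimension\<close>

definition supported :: "(nat \<times> nat) set \<Rightarrow> 'a::field_char_0 poly poly set"
  where "supported S = {f. \<forall>i j. (i, j) \<notin> S \<longrightarrow> coeff (coeff f j) i = 0}"

lemma subspace_supported: "poly2.subspace (supported S)"
  unfolding poly2.subspace_def supported_def by (simp add: coeff_scale2)

text \<open>A term x^a y^b of \<open>diff_x f\<close> comes from x^(a+1) y^b in \<open>f\<close>,
  and similarly for \<open>diff_y h\<close>. Stating the closure of \<open>S\<close> with
  \<open>Suc\<close> avoids truncated subtraction.\<close>

lemma diff_mult_supported:
  assumes f: "f \<in> supported S" and h: "h \<in> supported S"
    and S: "\<And>a b c d. (Suc a, b) \<in> S \<Longrightarrow> (c, Suc d) \<in> S \<Longrightarrow> (a + c, b + d) \<in> S"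
  shows "diff_x f * diff_y h \<in> supported S"
  unfolding supported_def
proof safe
  fix i j
  assume ij: "(i, j) \<notin> S"
  have "coeff (coeff (diff_x f) b) a * coeff (coeff (diff_y h) (j - b)) (i - a) = 0"
    if "a \<le> i" "b \<le> j" for a b
  proof -
    have "(Suc a, b) \<notin> S \<or> (i - a, Suc (j - b)) \<notin> S"
      using S[of a b "i - a" "j - b"] that ij by auto
    then show ?thesis
      using f h by (auto simp: supported_def coeff_diff_x coeff_diff_y simp del: of_nat_Suc)
  qed
  then show "coeff (coeff (diff_x f * diff_y h) j) i = 0"
    by (auto simp: coeff_mult coeff_sum intro!: sum.neutral)
qed

text \<open>The two products in the bracket differ by exchanging the arguments, so one closure
  condition on \<open>S\<close> handles both.\<close>

lemma Lie_subset_supported: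
  fixes f g :: "'a::field_char_0 poly poly"
  assumes "f \<in> supported S" "g \<in> supported S"
    and "\<And>a b c d. (Suc a, b) \<in> S \<Longrightarrow> (c, Suc d) \<in> S \<Longrightarrow> (a + c, b + d) \<in> S"
  shows "Lie f g \<subseteq> supported S"
  unfolding Lie_def
proof (rule hull_minimal)
  show "lie_subalgebra (supported S :: 'a poly poly set)"
    unfolding lie_subalgebra_def poisson_def
  proof (intro conjI ballI subspace_supported)
    fix f h :: "'a poly poly"
    assume fh: "f \<in> supported S" "h \<in> supported S"
    have "diff_x f * diff_y h \<in> supported S" "diff_x h * diff_y f \<in> supported S"
      by (intro diff_mult_supported fh assms(3); assumption)+
    then show "diff_x f * diff_y h - diff_y f * diff_x h \<in> supported S"
      by (simp add: mult.commute poly2.subspace_diff[OF subspace_supported])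
  qed
qed (use assms in auto)

text \<open>Monomials with exponents outside \<open>S\<close> are independent modulo
  \<open>W\<close>, so their representatives in \<open>poly2.span B\<close> would be infinitely many
  independent vectors in a finite-dimensional space.\<close>

lemma not_finite_codim_if_supported:
  fixes W :: "'a::field_char_0 poly poly set"
  assumes WS: "W \<subseteq> supported S" and inf: "infinite (- S)"
  shows "\<not> poly2.finite_codim W"
proof
  let ?m = "\<lambda>(i, j). mon i j :: 'a poly poly"
  assume "poly2.finite_codim W"
  then obtain B where W: "poly2.subspace W" and B: "finite B"
    and "\<And>v. \<exists>u\<in>poly2.span B. v - u \<in> W"
    unfolding poly2.finite_codim_def by blast
  then obtain u where u: "\<And>v. u v \<in> poly2.span B" "\<And>v. v - u v \<in> W"
    by metis
  let ?u = "\<lambda>t. u (?m t)"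
  \<comment> \<open>A relation between the representatives puts the same combination of monomials
    into \<open>W\<close>; its coefficients outside \<open>S\<close> are the \<open>c t\<close>,
    which must vanish.\<close>
  have lin: "c t = 0" if "finite T" "T \<subseteq> - S" "(\<Sum>t\<in>T. scale2 (c t) (?u t)) = 0" "t \<in> T" for T c t
  proof -
    have "(\<Sum>t\<in>T. scale2 (c t) (?m t - ?u t)) \<in> W"
      by (intro poly2.subspace_sum poly2.subspace_scale W u)
    then have sup: "(\<Sum>t\<in>T. scale2 (c t) (?m t)) \<in> supported S"
      using that(3) WS by (auto simp: poly2.scale_right_diff_distrib sum_subtractf)
    have "coeff (coeff (\<Sum>s\<in>T. scale2 (c s) (?m s)) (snd t)) (fst t) =
        (\<Sum>s\<in>T. if s = t then c s else 0)"
      unfolding coeff_sum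
      by (intro sum.cong) (auto simp: coeff_scale2 coeff_mon split: prod.splits)
    also have "\<dots> = c t"
      using that by simp
    finally show ?thesis
      using sup that(2,4) by (cases t) (auto simp: supported_def)
  qed
  \<comment> \<open>\<open>poly2.independent\<close> speaks of a set, so coinciding representatives
    are excluded separately, by the relation with coefficients 1 and -1.\<close>
  have inj: "inj_on ?u (- S)"
  proof (rule inj_onI, rule ccontr)
    fix s t
    assume st: "s \<in> - S" "t \<in> - S" "?u s = ?u t" "s \<noteq> t"
    have "(1::'a) = 0"
      using lin[of "{s, t}" "\<lambda>r. if r = s then 1 else -1" s] st by simp
    then show False by simp
  qed
  have "poly2.independent (?u ` (- S))"
    unfolding poly2.dependent_explicit
  proof safe
    fix U c v
    assume U: "finite U" "U \<subseteq> ?u ` (- S)" "(\<Sum>v\<in>U. scale2 (c v) v) = 0" "v \<in> U" "c v \<noteq> 0"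
    then obtain T where T: "T \<subseteq> - S" "U = ?u ` T"
      by (meson subset_image_iff)
    then have injT: "inj_on ?u T"
      using inj inj_on_subset by blast
    then have "finite T" "(\<Sum>t\<in>T. scale2 (c (?u t)) (?u t)) = 0"
      using U T by (auto simp: sum.reindex finite_image_iff)
    then show False
      using lin[of T "\<lambda>t. c (?u t)"] T U by blast
  qed
  moreover have "?u ` (- S) \<subseteq> poly2.span B"
    using u by auto
  ultimately have "finite (?u ` (- S))"
    using poly2.independent_span_bound[OF B] by blast
  then show False
    using inj inf finite_imageD by blast
qed

lemma mon_mem_supported: "(i, j) \<in> S \<Longrightarrow> mon i j \<in> supported S"
  by (auto simp: supported_def coeff_mon split: if_splits)

lemma not_finite_codim_Lie:
  fixes p q :: nat
  assumes "(p, 0) \<in> S" "(0, q) \<in> S" "infinite (- S)"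
    and "\<And>a b c d. (Suc a, b) \<in> S \<Longrightarrow> (c, Suc d) \<in> S \<Longrightarrow> (a + c, b + d) \<in> S"
  shows "\<not> poly2.finite_codim (Lie (var_x ^ p) (var_y ^ q) :: 'a::field_char_0 poly poly set)"
proof (rule not_finite_codim_if_supported[OF Lie_subset_supported])
  show "var_x ^ p \<in> (supported S :: 'a poly poly set)"
    using mon_mem_supported[OF assms(1)] by simp
  show "var_y ^ q \<in> (supported S :: 'a poly poly set)"
    using mon_mem_supported[OF assms(2)] by simp
qed (use assms in auto)

section \<open>The exponents (2,3) and (3,2)\<close>

text \<open>An abstract \<open>P\<close> lets the same argument serve both orders of the
  variables.\<close>

lemma exponents_cofinite:
  fixes P :: "nat \<Rightarrow> nat \<Rightarrow> bool"
  assumes step: "\<And>a b c d. P a b \<Longrightarrow> P c d \<Longrightarrow> a * d \<noteq> b * c \<Longrightarrow> P (a + c - 1) (b + d - 1)"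
    and gens: "P 2 0" "P 0 3"
    and ij: "(i, j) \<notin> {(0, 0), (1, 0), (0, 1), (0, 2), (1, 1)}"
  shows "P i j"
proof -
  have 12: "P 1 2" using step[OF gens] by simp
  have 21: "P 2 1" using step[OF gens(1) 12] by (simp add: numeral_eq_Suc)
  \<comment> \<open>Bracketing with x^2 y raises a power of x by one; below, x y^2 does the same for
    powers of y.\<close>
  have x: "P n 0" if "n \<ge> 2" for n
    using that
  proof (induction n rule: dec_induct)
    case (step n)
    then show ?case using assms(1)[OF step.IH 21] by (simp add: numeral_eq_Suc)
  qed (fact gens)
  have y: "P 0 n" if "n \<ge> 3" for n
    using that
  proof (induction n rule: dec_induct)
    case (step n)
    then show ?case using assms(1)[OF 12 step.IH] by (simp add: numeral_eq_Suc)
  qed (fact gens)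
  \<comment> \<open>Bracket of x^(k+1) and y^(l+1).\<close>
  have xy: "P k l" if "k \<ge> 1" "l \<ge> 2" for k l
    using step[OF x[of "Suc k"] y[of "Suc l"]] that by simp
  \<comment> \<open>The bracket with x^2 turns x^(k-1) y^2 into a multiple of x^k y.\<close>
  have x1: "P k 1" if "k \<ge> 2" for k
    using step[OF gens(1) xy[of "k - 1" 2]] that by (simp add: numeral_eq_Suc)
  have "j = 0 \<and> i \<ge> 2 \<or> i = 0 \<and> j \<ge> 3 \<or> j = 1 \<and> i \<ge> 2 \<or> i \<ge> 1 \<and> j \<ge> 2"
    using ij by (simp, presburger)
  then show ?thesis
    using x y xy x1 by blast
qed

lemma finite_codim_Lie:
  fixes p q :: nat
  assumes "(p, q) = (2, 3) \<or> (p, q) = (3, 2)"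
  shows "poly2.finite_codim (Lie (var_x ^ p) (var_y ^ q) :: 'a::field_char_0 poly poly set)"
proof -
  let ?L = "Lie (var_x ^ p) (var_y ^ q) :: 'a poly poly set"
  let ?F = "{(0, 0), (1, 0), (0, 1), (0, 2), (1, 1)} :: (nat \<times> nat) set"
  have p: "mon p 0 \<in> ?L" and q: "mon 0 q \<in> ?L"
    using generators_mem_Lie by auto
  show ?thesis
  proof (cases "p = 2")
    case True
    then have "mon i j \<in> ?L" if "(i, j) \<notin> ?F" for i j
      using exponents_cofinite[of "\<lambda>i j. mon i j \<in> ?L", OF mon_mem_Lie _ _ that] p q assms by simp
    then show ?thesis
      by (intro finite_codim_if_mon[where F = ?F] subspace_Lie) auto
  next
    case False
    \<comment> \<open>Exchanging the variables only changes the sign of the determinant.\<close>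
    have sym: "mon (b + d - 1) (a + c - 1) \<in> ?L"
      if "mon b a \<in> ?L" "mon d c \<in> ?L" "a * d \<noteq> b * c" for a b c d
      using mon_mem_Lie[OF that(1,2)] that(3) by (metis mult.commute)
    have "mon i j \<in> ?L" if "(j, i) \<notin> ?F" for i j
      using exponents_cofinite[of "\<lambda>i j. mon j i \<in> ?L", OF sym _ _ that] p q assms False by simp
    then show ?thesis
      by (intro finite_codim_if_mon[where F = "prod.swap ` ?F"] subspace_Lie) auto
  qed
qed

section \<open>The remaining exponents\<close>

lemma infinite_Compl_if_unbounded_column:
  assumes "\<And>n. \<exists>m\<ge>n. (i, m) \<notin> S"
  shows "infinite (- S :: (nat \<times> nat) set)"
proof
  assume "finite (- S)"
  then have "finite (snd ` (- S))" by simp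
  then obtain N where "\<forall>m\<in>snd ` (- S). m < N"
    using finite_nat_set_iff_bounded by blast
  moreover obtain m where "m \<ge> N" "(i, m) \<notin> S"
    using assms by blast
  ultimately show False by force
qed

text \<open>The hypothesis includes \<open>D = 0\<close>, where the congruence becomes an
  equation.\<close>

lemma not_finite_codim_Lie_index:
  fixes p q :: nat
  defines "D \<equiv> (int p - 1) * (int q - 1) - 1"
  assumes D: "\<not> D dvd 1"
  shows "\<not> poly2.finite_codim (Lie (var_x ^ p) (var_y ^ q) :: 'a::field_char_0 poly poly set)"
proof -
  define S where "S = {(i, j). D dvd (int q - 1) * (int i - 1) + (int j - 1)}"
  show ?thesis
  proof (rule not_finite_codim_Lie[where S = S])
    \<comment> \<open>The linear form takes the values \<open>D\<close> and 0 at the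
      generators.\<close>
    show "(p, 0) \<in> S" "(0, q) \<in> S"
      by (simp_all add: S_def D_def algebra_simps)
    show "infinite (- S)"
    proof (rule infinite_Compl_if_unbounded_column[of 1])
      fix n
      \<comment> \<open>In column 1 the form is j - 1, and a non-unit cannot divide two consecutive
        integers.\<close>
      have "\<not> (D dvd int n - 1 \<and> D dvd int (Suc n) - 1)"
        using D dvd_diff[of D "int (Suc n) - 1" "int n - 1"] by auto
      then show "\<exists>m\<ge>n. (1, m) \<notin> S"
        by (auto simp: S_def intro: exI[of _ n] exI[of _ "Suc n"])
    qed
    fix a b c d
    assume "(Suc a, b) \<in> S" "(c, Suc d) \<in> S"
    then have "D dvd (int q - 1) * int a + (int b - 1)" "D dvd (int q - 1) * (int c - 1) + int d"
      by (simp_all add: S_def)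
    \<comment> \<open>Thanks to the shift by (1,1), the values of the form add up exactly under the
      bracket.\<close>
    from dvd_add[OF this] show "(a + c, b + d) \<in> S"
      by (simp add: S_def algebra_simps)
  qed
qed

text \<open>Here \<open>D\<close> would be -1 and the congruence excludes nothing. Instead, degree
  at most 1 in one variable is preserved: each product in the bracket differentiates one factor in
  that variable, giving degree at most 1 + 1 - 1.\<close>

lemma not_finite_codim_Lie_linear:
  fixes p q :: nat
  assumes "p = 1 \<or> q = 1"
  shows "\<not> poly2.finite_codim (Lie (var_x ^ p) (var_y ^ q) :: 'a::field_char_0 poly poly set)"
  using assms
proof
  assume "p = 1"
  moreover have "infinite (- {(i, j :: nat). i \<le> (1::nat)})"
    by (rule infinite_Compl_if_unbounded_column[of 2]) auto
  ultimately show ?thesis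
    by (intro not_finite_codim_Lie[where S = "{(i, j). i \<le> 1}"]) auto
next
  assume "q = 1"
  moreover have "infinite (- {(i :: nat, j). j \<le> (1::nat)})"
    by (rule infinite_Compl_if_unbounded_column[of 0]) (simp, presburger)
  ultimately show ?thesis
    by (intro not_finite_codim_Lie[where S = "{(i, j). j \<le> 1}"]) auto
qed

theorem corollary9:
  fixes p q :: nat
  assumes "p > 0" and "q > 0"
  shows "poly2.finite_codim (Lie (var_x ^ p) (var_y ^ q) :: 'a::field_char_0 poly poly set)
    \<longleftrightarrow> (p, q) = (2, 3) \<or> (p, q) = (3, 2)"
proof
  assume fin: "poly2.finite_codim (Lie (var_x ^ p) (var_y ^ q) :: 'a poly poly set)"
  have "p \<noteq> 1" "q \<noteq> 1"
    using fin not_finite_codim_Lie_linear by blast+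
  then obtain a b where ab: "p = a + 2" "q = b + 2"
    using assms le_Suc_ex[of 2 p] le_Suc_ex[of 2 q] by (force simp: add.commute)
  have "((int p - 1) * (int q - 1) - 1) dvd 1"
    using fin not_finite_codim_Lie_index by blast
  then have "\<bar>(int p - 1) * (int q - 1) - 1\<bar> = 1"
    by simp
  \<comment> \<open>For exponents at least 2 the determinant is a natural number, which rules out
    the value -1.\<close>
  moreover have "(int p - 1) * (int q - 1) - 1 = int (a * b + a + b)"
    by (simp add: ab algebra_simps)
  ultimately have "a * b + a + b = 1"
    by linarith
  then have "a = 0 \<and> b = 1 \<or> a = 1 \<and> b = 0"
    by (cases a; cases b) auto
  then show "(p, q) = (2, 3) \<or> (p, q) = (3, 2)"
    using ab by auto
qed (rule finite_codim_Lie)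

end
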